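(* Let $L$ be a fully interpreted language without a truth predicate, and let $\mathcal L^0$ be the language constructed from $L$ and $T(x)$ as in the context. Then $\mathcal L^0$ is fully interpreted in the definitional interpretation (a sentence $A$ of $\mathcal L^0$ is true iff $\#A\in G(U)$, false iff $\#A\in F(U)$).
   Context: **Languages.** A language is a countably infinite set of well-formed sentences of finite length over a countable set of symbols, including numerals for natural numbers. Connectives are syntactic operations with unique readability. The language $L$ is closed under $\neg,\vee,\wedge,\rightarrow,\leftrightarrow$, and the components of a compound sentence of $L$ are sentences of $L$. A predicate $P$ with (nonempty) domain $X_P$ is a formula $P(x)$ (possibly with $x$ a tuple of variables) such that $P(x)$ is a sentence for each assignment of $x\in X_P$. For every predicate $P$ of $L$, $\forall xP(x)$ and $\exists xP(x)$ are sentences of $L$. **Fully interpreted.** A language is fully interpreted if every sentence is either true or false (not both) and the classical rules hold: $\neg A$ is true iff $A$ is false, and false iff $A$ is true; $A\vee B$ is true iff $A$ or $B$ is true, false iff both are false; $A\wedge B$ is true iff both are true, false iff $A$ or $B$ is false; $A\rightarrow B$ is true iff $A$ is false or $B$ is true, false iff $A$ is true and $B$ is false; $A\leftrightarrow B$ is true iff $A,B$ are both true or both false, false iff one is true and the other false (for sentences $A,B$ of the language); for a predicate $P$ with domain $X_P$, $\forall xP(x)$ is true iff $P(x)$ is true for every $x\in X_P$, false iff $P(x)$ is false for some $x\in X_P$; $\exists xP(x)$ is true iff $P(x)$ is true for some $x\in X_P$, false iff $P(x)$ is false for every $x\in X_P$. **The language $\mathcal L$.** $L$ is a fully interpreted language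 without a truth predicate; $T(x)$ is a new formula not in $L$. $\mathcal L_0$ consists of the sentences of $L$, the sentences $T(\mathbf n)$ for all numerals $\mathbf n$, the sentences $\forall xT(x)$, $\exists xT(x)$, $\forall xT(\lceil T(x)\rceil)$, $\exists xT(\lceil T(x)\rceil)$, and, for every predicate $P$ of $L$, the sentences $\forall xT(\lceil P(x)\rceil)$, $\exists xT(\lceil P(x)\rceil)$ (all these are syntactically distinct and not in $L$). $\mathcal L_{n+1}$ consists of $A,\neg A,A\vee B,A\wedge B,A\rightarrow B,A\leftrightarrow B$ for $A,B\in\mathcal L_n$, and $\mathcal L=\bigcup_{n\ge0}\mathcal L_n$. A (injective) Gödel numbering is fixed; $\#A$ is the Gödel number of $A$, $\lceil A\rceil$ the numeral of $\#A$, and $D$ the set of Gödel numbers of all sentences of $\mathcal L$. $U\subseteq D$ is consistent if for no sentence $A$ of $\mathcal L$ both $\#A$ and $\#[\neg A]$ are in $U$. **The sets $G(U)$, $F(U)$.** Let $\mathcal P_1$ (resp. $\mathcal P_2$) be the set of predicates $P$ of $L$ with $P(x)$ true (resp. false) for every $x\in X_P$, and $\mathcal P_3$ the set of those with $P(x)$ true for some but not all $x\in X_P$. Let $W=\{\#A: A$ a true sentence of $L\}$. For a proper subset $U$ of $D$, put $G_0(\emptyset)=W$, and for $U\neq\emptyset$ let $G_0(U)$ be the union of $W$ and the following sets: $\{\#T(\lceil A\rceil): A\in\mathcal L,\ \#A\in U\}$; $\{\#[\neg T(\lceil A\rceil)]: A\in\mathcal L,\ \#[\neg A]\in U\}$;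 the Gödel numbers of $\neg\forall xT(x)$, $\exists xT(x)$, $\neg\forall xT(\lceil T(x)\rceil)$, $\exists xT(\lceil T(x)\rceil)$; of $\forall xT(\lceil P(x)\rceil)$, $\exists xT(\lceil P(x)\rceil)$ for $P\in\mathcal P_1$; of $\neg\forall xT(\lceil P(x)\rceil)$, $\neg\exists xT(\lceil P(x)\rceil)$ for $P\in\mathcal P_2$; of $\neg\forall xT(\lceil P(x)\rceil)$, $\exists xT(\lceil P(x)\rceil)$ for $P\in\mathcal P_3$. Given $G_n(U)$, let $G_{n+1}(U)$ be $G_n(U)$ together with, for all sentences $A,B$ of $\mathcal L$ (writing "$A\in G_n$" for $\#A\in G_n(U)$): $\#[\neg\neg A]$ if $A\in G_n$; $\#[A\vee B]$ if $A\in G_n$ or $B\in G_n$; $\#[A\wedge B]$ if $A,B\in G_n$; $\#[A\rightarrow B]$ if $\neg A\in G_n$ or $B\in G_n$; $\#[A\leftrightarrow B]$ if $A,B\in G_n$ or $\neg A,\neg B\in G_n$; $\#[\neg(A\vee B)]$ if $\neg A,\neg B\in G_n$; $\#[\neg(A\wedge B)]$ if $\neg A\in G_n$ or $\neg B\in G_n$; $\#[\neg(A\rightarrow B)]$ if $A,\neg B\in G_n$; $\#[\neg(A\leftrightarrow B)]$ if $A,\neg B\in G_n$ or $\neg A,B\in G_n$. Put $G(U)=\bigcup_{n\ge 0}G_n(U)$ and $F(U)=\{\#A:\#[\neg A]\in G(U)\}$. **The language $\mathcal L^0$.** $U$ now denotes the smallest consistent subset of $D$ with $U=G(U)$ (it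 exists). $\mathcal L^0$ is the set of sentences of $\mathcal L$ whose Gödel number is in $G(U)$ or in $F(U)$. Let $X_T=\{\lceil A\rceil: A$ a sentence of $\mathcal L^0\}$. For $\mathcal L^0$ the quantifier rules refer to the predicates of $L$, to $T$ (domain $X_T$), $T(\lceil T(\cdot)\rceil)$ (domain $X_T$) and $T(\lceil P(\cdot)\rceil)$ (domain $X_P$) for predicates $P$ of $L$. *)

theory Defs
  imports "HOL-Library.Countable"
begin

text \<open>
  Formulas and sentences are finite strings over an alphabet of symbols \<^typ>\<open>'c\<close>, which is of class
  \<open>countable\<close> wherever that matters. The type \<^typ>\<open>'x\<close> contains the objects over which variables
  may range (the numerals among them); tuples of variables are covered because \<^typ>\<open>'x\<close> is arbitrary.
\<close>

record 'c connectives =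
  Neg :: "'c list \<Rightarrow> 'c list"
  Disj :: "'c list \<Rightarrow> 'c list \<Rightarrow> 'c list"
  Conj :: "'c list \<Rightarrow> 'c list \<Rightarrow> 'c list"
  Impl :: "'c list \<Rightarrow> 'c list \<Rightarrow> 'c list"
  Equiv :: "'c list \<Rightarrow> 'c list \<Rightarrow> 'c list"

text \<open>
  A predicate \<open>P\<close> as the quantifier rules see it: its domain, the map \<open>x \<mapsto> P(x)\<close> (only its values on
  the domain matter), and the sentences \<open>\<forall>xP(x)\<close> and \<open>\<exists>xP(x)\<close>.
\<close>

record ('c, 'x) predicate =
  domain :: "'x set"
  inst :: "'x \<Rightarrow> 'c list"
  univ :: "'c list"
  exis :: "'c list"

text \<open>
  Countability of \<open>S\<close> is automatic, since there are only countably many strings. Closure under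
  components is required only of the base language (in \<open>truth_extension\<close> below): the language \<open>L0\<close> may
  contain \<open>A \<or> B\<close> without containing \<open>B\<close>.
\<close>

definition language ::
  "('c::countable, 'm) connectives_scheme \<Rightarrow> 'c list set \<Rightarrow> ('c, 'x) predicate set \<Rightarrow> bool" where
  "language K S Q \<longleftrightarrow>
     infinite S \<and>
     (\<forall>A\<in>S. Neg K A \<in> S) \<and>
     (\<forall>A\<in>S. \<forall>B\<in>S. Disj K A B \<in> S \<and> Conj K A B \<in> S \<and> Impl K A B \<in> S \<and> Equiv K A B \<in> S) \<and>
     (\<forall>P\<in>Q. domain P \<noteq> {} \<and> (\<forall>x\<in>domain P. inst P x \<in> S) \<and> univ P \<in> S \<and> exis P \<in> S)"

text \<open>\<open>tr\<close> and \<open>fa\<close> are the interpretation: which sentences are true and which are false.\<close>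

definition fully_interpreted ::
  "('c::countable, 'm) connectives_scheme \<Rightarrow> 'c list set \<Rightarrow> ('c, 'x) predicate set
     \<Rightarrow> ('c list \<Rightarrow> bool) \<Rightarrow> ('c list \<Rightarrow> bool) \<Rightarrow> bool" where
  "fully_interpreted K S Q tr fa \<longleftrightarrow>
     language K S Q \<and>
     (\<forall>A\<in>S. (tr A \<or> fa A) \<and> \<not> (tr A \<and> fa A)) \<and>
     (\<forall>A\<in>S.
        (tr (Neg K A) \<longleftrightarrow> fa A) \<and>
        (fa (Neg K A) \<longleftrightarrow> tr A)) \<and>
     (\<forall>A\<in>S. \<forall>B\<in>S.
        (tr (Disj K A B) \<longleftrightarrow> tr A \<or> tr B) \<and>
        (fa (Disj K A B) \<longleftrightarrow> fa A \<and> fa B) \<and>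
        (tr (Conj K A B) \<longleftrightarrow> tr A \<and> tr B) \<and>
        (fa (Conj K A B) \<longleftrightarrow> fa A \<or> fa B) \<and>
        (tr (Impl K A B) \<longleftrightarrow> fa A \<or> tr B) \<and>
        (fa (Impl K A B) \<longleftrightarrow> tr A \<and> fa B) \<and>
        (tr (Equiv K A B) \<longleftrightarrow> (tr A \<and> tr B) \<or> (fa A \<and> fa B)) \<and>
        (fa (Equiv K A B) \<longleftrightarrow> (tr A \<and> fa B) \<or> (fa A \<and> tr B))) \<and>
     (\<forall>P\<in>Q.
        (tr (univ P) \<longleftrightarrow> (\<forall>x\<in>domain P. tr (inst P x))) \<and>
        (fa (univ P) \<longleftrightarrow> (\<exists>x\<in>domain P. fa (inst P x))) \<and>
        (tr (exis P) \<longleftrightarrow> (\<exists>x\<in>domain P. tr (inst P x))) \<and>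
        (fa (exis P) \<longleftrightarrow> (\<forall>x\<in>domain P. fa (inst P x))))"

text \<open>
  The base language \<open>L\<close>. Its predicates are certain formulas \<open>P\<close>, i.e. strings; \<open>Inst P x\<close> is \<open>P(x)\<close>,
  and \<open>Forall P\<close>, \<open>Exists P\<close> are \<open>\<forall>xP(x)\<close>, \<open>\<exists>xP(x)\<close>.
\<close>

record ('c, 'x) base_language = "'c connectives" +
  Sent :: "'c list set"
  Pred :: "'c list set"
  Dom :: "'c list \<Rightarrow> 'x set"
  Inst :: "'c list \<Rightarrow> 'x \<Rightarrow> 'c list"
  Forall :: "'c list \<Rightarrow> 'c list"
  Exists :: "'c list \<Rightarrow> 'c list"
  Numeral :: "nat \<Rightarrow> 'x"
  Tru :: "'c list \<Rightarrow> bool"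
  Fls :: "'c list \<Rightarrow> bool"

definition predicate_of ::
  "('c, 'x, 'm) base_language_scheme \<Rightarrow> 'c list \<Rightarrow> ('c, 'x) predicate" where
  "predicate_of L P =
     \<lparr>domain = Dom L P, inst = Inst L P, univ = Forall L P, exis = Exists L P\<rparr>"

text \<open>
  The additional data for the language with \<open>T\<close>: \<open>T (Numeral n)\<close> is the sentence \<open>T(n)\<close>;
  \<open>ForallT\<close>, \<open>ForallTT\<close> and \<open>ForallTP P\<close> are \<open>\<forall>xT(x)\<close>, \<open>\<forall>xT(\<lceil>T(x)\<rceil>)\<close> and \<open>\<forall>xT(\<lceil>P(x)\<rceil>)\<close>, and similarly
  for \<open>\<exists>\<close>. \<open>GN\<close> is the Goedel numbering.
\<close>

record ('c, 'x) truth_language = "('c, 'x) base_language" +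
  T :: "'x \<Rightarrow> 'c list"
  ForallT :: "'c list"
  ExistsT :: "'c list"
  ForallTT :: "'c list"
  ExistsTT :: "'c list"
  ForallTP :: "'c list \<Rightarrow> 'c list"
  ExistsTP :: "'c list \<Rightarrow> 'c list"
  GN :: "'c list \<Rightarrow> nat"

definition T_sentences :: "('c, 'x) truth_language \<Rightarrow> 'c list set" where
  "T_sentences L =
     range (\<lambda>n. T L (Numeral L n)) \<union>
     {ForallT L, ExistsT L, ForallTT L, ExistsTT L} \<union>
     ForallTP L ` Pred L \<union> ExistsTP L ` Pred L"

primrec LL_stage :: "('c, 'x) truth_language \<Rightarrow> nat \<Rightarrow> 'c list set" where
  "LL_stage L 0 = Sent L \<union> T_sentences L"
| "LL_stage L (Suc n) =
     LL_stage L n \<union>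
     {Neg L A | A. A \<in> LL_stage L n} \<union>
     {Disj L A B | A B. A \<in> LL_stage L n \<and> B \<in> LL_stage L n} \<union>
     {Conj L A B | A B. A \<in> LL_stage L n \<and> B \<in> LL_stage L n} \<union>
     {Impl L A B | A B. A \<in> LL_stage L n \<and> B \<in> LL_stage L n} \<union>
     {Equiv L A B | A B. A \<in> LL_stage L n \<and> B \<in> LL_stage L n}"

definition LL :: "('c, 'x) truth_language \<Rightarrow> 'c list set" where
  "LL L = (\<Union>n. LL_stage L n)"

text \<open>
  Unique readability and syntactic distinctness are expressed together: a \<open>shape\<close> is a way to form a
  sentence, and different shapes, with sentences as components, are spelled by different strings.
  Nothing is required of strings that are not well formed, where e.g. infix notation is ambiguous.
\<close>

datatype 'c shape =
    SNeg "'c list"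
  | SDisj "'c list" "'c list"
  | SConj "'c list" "'c list"
  | SImpl "'c list" "'c list"
  | SEquiv "'c list" "'c list"
  | ST nat
  | SForallT | SExistsT | SForallTT | SExistsTT
  | SForallTP "'c list" | SExistsTP "'c list"

primrec spell :: "('c, 'x) truth_language \<Rightarrow> 'c shape \<Rightarrow> 'c list" where
  "spell L (SNeg A) = Neg L A"
| "spell L (SDisj A B) = Disj L A B"
| "spell L (SConj A B) = Conj L A B"
| "spell L (SImpl A B) = Impl L A B"
| "spell L (SEquiv A B) = Equiv L A B"
| "spell L (ST n) = T L (Numeral L n)"
| "spell L SForallT = ForallT L"
| "spell L SExistsT = ExistsT L"
| "spell L SForallTT = ForallTT L"
| "spell L SExistsTT = ExistsTT L"
| "spell L (SForallTP P) = ForallTP L P"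
| "spell L (SExistsTP P) = ExistsTP L P"

definition well_formed_shapes :: "('c, 'x) truth_language \<Rightarrow> 'c shape set" where
  "well_formed_shapes L =
     SNeg ` LL L \<union>
     (\<Union>A\<in>LL L. \<Union>B\<in>LL L. {SDisj A B, SConj A B, SImpl A B, SEquiv A B}) \<union>
     range ST \<union> {SForallT, SExistsT, SForallTT, SExistsTT} \<union>
     SForallTP ` Pred L \<union> SExistsTP ` Pred L"

definition quote :: "('c, 'x) truth_language \<Rightarrow> 'c list \<Rightarrow> 'x" where
  "quote L A = Numeral L (GN L A)"

locale truth_extension =
  fixes L :: "('c::countable, 'x) truth_language"
  assumes T_new: "T_sentences L \<inter> Sent L = {}"
    and unique_readability: "inj_on (spell L) (well_formed_shapes L)"
    and component_Neg: "\<And>A. A \<in> LL L \<Longrightarrow> Neg L A \<in> Sent L \<Longrightarrow> A \<in> Sent L"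
    and component_binary:
      "\<And>A B. A \<in> LL L \<Longrightarrow> B \<in> LL L \<Longrightarrow>
         Disj L A B \<in> Sent L \<or> Conj L A B \<in> Sent L \<or> Impl L A B \<in> Sent L \<or> Equiv L A B \<in> Sent L \<Longrightarrow>
         A \<in> Sent L \<and> B \<in> Sent L"
    and GN_inj: "inj_on (GN L) (LL L)"

text \<open>\<open>P\<close> is a truth predicate for \<open>L\<close> if \<open>P(\<lceil>A\<rceil>) \<leftrightarrow> A\<close> is a true sentence for every sentence \<open>A\<close> of \<open>L\<close>.\<close>

definition has_truth_predicate :: "('c, 'x) truth_language \<Rightarrow> bool" where
  "has_truth_predicate L \<longleftrightarrow>
     (\<exists>P\<in>Pred L. \<forall>A\<in>Sent L. quote L A \<in> Dom L P \<and> Tru L (Equiv L (Inst L P (quote L A)) A))"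

definition D :: "('c, 'x) truth_language \<Rightarrow> nat set" where
  "D L = GN L ` LL L"

definition consistent :: "('c, 'x) truth_language \<Rightarrow> nat set \<Rightarrow> bool" where
  "consistent L U \<longleftrightarrow> \<not> (\<exists>A\<in>LL L. GN L A \<in> U \<and> GN L (Neg L A) \<in> U)"

definition W :: "('c, 'x) truth_language \<Rightarrow> nat set" where
  "W L = {GN L A | A. A \<in> Sent L \<and> Tru L A}"

definition P1 :: "('c, 'x) truth_language \<Rightarrow> 'c list set" where
  "P1 L = {P \<in> Pred L. \<forall>x\<in>Dom L P. Tru L (Inst L P x)}"

definition P2 :: "('c, 'x) truth_language \<Rightarrow> 'c list set" where
  "P2 L = {P \<in> Pred L. \<forall>x\<in>Dom L P. Fls L (Inst L P x)}"

definition P3 :: "('c, 'x) truth_language \<Rightarrow> 'c list set" where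
  "P3 L = {P \<in> Pred L. (\<exists>x\<in>Dom L P. Tru L (Inst L P x)) \<and> \<not> (\<forall>x\<in>Dom L P. Tru L (Inst L P x))}"

text \<open>
  \<open>G\<close> is defined on all sets of numbers, but used only for consistent subsets of \<open>D\<close>; these are
  proper subsets of \<open>D\<close>.
\<close>

definition G_zero :: "('c, 'x) truth_language \<Rightarrow> nat set \<Rightarrow> nat set" where
  "G_zero L U =
     (if U = {} then W L else
      W L \<union>
      {GN L (T L (quote L A)) | A. A \<in> LL L \<and> GN L A \<in> U} \<union>
      {GN L (Neg L (T L (quote L A))) | A. A \<in> LL L \<and> GN L (Neg L A) \<in> U} \<union>
      {GN L (Neg L (ForallT L)), GN L (ExistsT L),
       GN L (Neg L (ForallTT L)), GN L (ExistsTT L)} \<union>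
      {GN L (ForallTP L P) | P. P \<in> P1 L} \<union>
      {GN L (ExistsTP L P) | P. P \<in> P1 L} \<union>
      {GN L (Neg L (ForallTP L P)) | P. P \<in> P2 L} \<union>
      {GN L (Neg L (ExistsTP L P)) | P. P \<in> P2 L} \<union>
      {GN L (Neg L (ForallTP L P)) | P. P \<in> P3 L} \<union>
      {GN L (ExistsTP L P) | P. P \<in> P3 L})"

definition G_step :: "('c, 'x) truth_language \<Rightarrow> nat set \<Rightarrow> nat set" where
  "G_step L X =
     (let mem = (\<lambda>A. GN L A \<in> X); neg = Neg L in
      X \<union>
      {GN L (neg (neg A)) | A. A \<in> LL L \<and> mem A} \<union>
      {GN L (Disj L A B) | A B. A \<in> LL L \<and> B \<in> LL L \<and> (mem A \<or> mem B)} \<union>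
      {GN L (Conj L A B) | A B. A \<in> LL L \<and> B \<in> LL L \<and> mem A \<and> mem B} \<union>
      {GN L (Impl L A B) | A B. A \<in> LL L \<and> B \<in> LL L \<and> (mem (neg A) \<or> mem B)} \<union>
      {GN L (Equiv L A B) | A B. A \<in> LL L \<and> B \<in> LL L \<and>
         ((mem A \<and> mem B) \<or> (mem (neg A) \<and> mem (neg B)))} \<union>
      {GN L (neg (Disj L A B)) | A B. A \<in> LL L \<and> B \<in> LL L \<and> mem (neg A) \<and> mem (neg B)} \<union>
      {GN L (neg (Conj L A B)) | A B. A \<in> LL L \<and> B \<in> LL L \<and> (mem (neg A) \<or> mem (neg B))} \<union>
      {GN L (neg (Impl L A B)) | A B. A \<in> LL L \<and> B \<in> LL L \<and> mem A \<and> mem (neg B)} \<union>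
      {GN L (neg (Equiv L A B)) | A B. A \<in> LL L \<and> B \<in> LL L \<and>
         ((mem A \<and> mem (neg B)) \<or> (mem (neg A) \<and> mem B))})"

primrec G_stage :: "('c, 'x) truth_language \<Rightarrow> nat set \<Rightarrow> nat \<Rightarrow> nat set" where
  "G_stage L U 0 = G_zero L U"
| "G_stage L U (Suc n) = G_step L (G_stage L U n)"

definition G :: "('c, 'x) truth_language \<Rightarrow> nat set \<Rightarrow> nat set" where
  "G L U = (\<Union>n. G_stage L U n)"

definition F :: "('c, 'x) truth_language \<Rightarrow> nat set \<Rightarrow> nat set" where
  "F L U = {GN L A | A. A \<in> LL L \<and> GN L (Neg L A) \<in> G L U}"

definition smallest_consistent_fixed_point :: "('c, 'x) truth_language \<Rightarrow> nat set \<Rightarrow> bool" where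
  "smallest_consistent_fixed_point L U \<longleftrightarrow>
     U \<subseteq> D L \<and> consistent L U \<and> U = G L U \<and>
     (\<forall>V. V \<subseteq> D L \<and> consistent L V \<and> V = G L V \<longrightarrow> U \<subseteq> V)"

definition L0 :: "('c, 'x) truth_language \<Rightarrow> nat set \<Rightarrow> 'c list set" where
  "L0 L U = {A \<in> LL L. GN L A \<in> G L U \<or> GN L A \<in> F L U}"

definition X_T :: "('c, 'x) truth_language \<Rightarrow> nat set \<Rightarrow> 'x set" where
  "X_T L U = quote L ` L0 L U"

text \<open>The predicates of \<open>L\<close>, then \<open>T(x)\<close>, \<open>T(\<lceil>T(x)\<rceil>)\<close> and \<open>T(\<lceil>P(x)\<rceil>)\<close> for the predicates \<open>P\<close> of \<open>L\<close>.\<close>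

definition L0_predicates ::
  "('c, 'x) truth_language \<Rightarrow> nat set \<Rightarrow> ('c, 'x) predicate set" where
  "L0_predicates L U =
     predicate_of L ` Pred L \<union>
     {\<lparr>domain = X_T L U, inst = T L, univ = ForallT L, exis = ExistsT L\<rparr>,
      \<lparr>domain = X_T L U, inst = (\<lambda>x. T L (quote L (T L x))),
        univ = ForallTT L, exis = ExistsTT L\<rparr>} \<union>
     (\<lambda>P. \<lparr>domain = Dom L P, inst = (\<lambda>x. T L (quote L (Inst L P x))),
            univ = ForallTP L P, exis = ExistsTP L P\<rparr>) ` Pred L"

end

theory Submission
  imports Defs
begin

text \<open>
  Membership in a fixed point \<open>U = G(U)\<close> obeys the positive half of every truth rule: the components
  of a sentence being decided suitably, the sentence or its negation is put into \<open>G(U)\<close>. On \<open>L0\<close>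
  every sentence is decided, and by consistency in only one way, so that these one-directional rules
  already determine all truth values, and no inversion of the construction of \<open>G(U)\<close> is needed.
\<close>

section \<open>Truth tables from one-directional rules\<close>

lemma fully_interpretedI:
  fixes K :: "('c::countable, 'm) connectives_scheme" and Q :: "('c, 'x) predicate set"
  assumes language: "language K S Q"
    and decided: "\<And>A. A \<in> S \<Longrightarrow> tr A \<or> fa A"
    and exclusive: "\<And>A. A \<in> S \<Longrightarrow> \<not> (tr A \<and> fa A)"
    and Neg: "\<And>A. A \<in> S \<Longrightarrow> tr A \<Longrightarrow> fa (Neg K A)" "\<And>A. A \<in> S \<Longrightarrow> fa A \<Longrightarrow> tr (Neg K A)"
    and Disj: "\<And>A B. A \<in> S \<Longrightarrow> B \<in> S \<Longrightarrow> tr A \<or> tr B \<Longrightarrow> tr (Disj K A B)"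
      "\<And>A B. A \<in> S \<Longrightarrow> B \<in> S \<Longrightarrow> fa A \<Longrightarrow> fa B \<Longrightarrow> fa (Disj K A B)"
    and Conj: "\<And>A B. A \<in> S \<Longrightarrow> B \<in> S \<Longrightarrow> tr A \<Longrightarrow> tr B \<Longrightarrow> tr (Conj K A B)"
      "\<And>A B. A \<in> S \<Longrightarrow> B \<in> S \<Longrightarrow> fa A \<or> fa B \<Longrightarrow> fa (Conj K A B)"
    and Impl: "\<And>A B. A \<in> S \<Longrightarrow> B \<in> S \<Longrightarrow> fa A \<or> tr B \<Longrightarrow> tr (Impl K A B)"
      "\<And>A B. A \<in> S \<Longrightarrow> B \<in> S \<Longrightarrow> tr A \<Longrightarrow> fa B \<Longrightarrow> fa (Impl K A B)"
    and Equiv: "\<And>A B. A \<in> S \<Longrightarrow> B \<in> S \<Longrightarrow> tr A \<and> tr B \<or> fa A \<and> fa B \<Longrightarrow> tr (Equiv K A B)"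
      "\<And>A B. A \<in> S \<Longrightarrow> B \<in> S \<Longrightarrow> tr A \<and> fa B \<or> fa A \<and> tr B \<Longrightarrow> fa (Equiv K A B)"
    and univ: "\<And>P. P \<in> Q \<Longrightarrow> \<forall>x\<in>domain P. tr (inst P x) \<Longrightarrow> tr (univ P)"
      "\<And>P x. P \<in> Q \<Longrightarrow> x \<in> domain P \<Longrightarrow> fa (inst P x) \<Longrightarrow> fa (univ P)"
    and exis: "\<And>P x. P \<in> Q \<Longrightarrow> x \<in> domain P \<Longrightarrow> tr (inst P x) \<Longrightarrow> tr (exis P)"
      "\<And>P. P \<in> Q \<Longrightarrow> \<forall>x\<in>domain P. fa (inst P x) \<Longrightarrow> fa (exis P)"
  shows "fully_interpreted K S Q tr fa"
proof -
  \<comment> \<open>On \<open>S\<close> falsity is non-truth, so it suffices to characterise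
    \<open>tr\<close> for each compound; the clauses for \<open>fa\<close> then follow by
    negation.\<close>
  have fa_iff: "fa A \<longleftrightarrow> \<not> tr A" if "A \<in> S" for A
    using decided exclusive that by blast
  have Neg_S: "Neg K A \<in> S" if "A \<in> S" for A
    using language that by (simp add: language_def)
  have binary_S: "Disj K A B \<in> S" "Conj K A B \<in> S" "Impl K A B \<in> S" "Equiv K A B \<in> S"
    if "A \<in> S" "B \<in> S" for A B
    using language that by (simp_all add: language_def)
  have pred_S: "univ P \<in> S" "exis P \<in> S" "\<And>x. x \<in> domain P \<Longrightarrow> inst P x \<in> S" if "P \<in> Q" for P
    using language that by (simp_all add: language_def)
  have Neg_iff: "tr (Neg K A) \<longleftrightarrow> \<not> tr A" if "A \<in> S" for A
    using Neg[of A] that Neg_S fa_iff by blast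
  \<comment> \<open>Each row of the table triggers one of the two rules. When it is the falsity
    rule, \<open>fa_iff\<close> for the compound excludes truth, which supplies the
    converse.\<close>
  have Disj_iff: "tr (Disj K A B) \<longleftrightarrow> tr A \<or> tr B" if "A \<in> S" "B \<in> S" for A B
    using Disj[OF that] fa_iff[OF that(1)] fa_iff[OF that(2)] binary_S[OF that, THEN fa_iff]
    by (cases "tr A"; cases "tr B"; simp)
  have Conj_iff: "tr (Conj K A B) \<longleftrightarrow> tr A \<and> tr B" if "A \<in> S" "B \<in> S" for A B
    using Conj[OF that] fa_iff[OF that(1)] fa_iff[OF that(2)] binary_S[OF that, THEN fa_iff]
    by (cases "tr A"; cases "tr B"; simp)
  have Impl_iff: "tr (Impl K A B) \<longleftrightarrow> (tr A \<longrightarrow> tr B)" if "A \<in> S" "B \<in> S" for A B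
    using Impl[OF that] fa_iff[OF that(1)] fa_iff[OF that(2)] binary_S[OF that, THEN fa_iff]
    by (cases "tr A"; cases "tr B"; simp)
  have Equiv_iff: "tr (Equiv K A B) \<longleftrightarrow> (tr A \<longleftrightarrow> tr B)" if "A \<in> S" "B \<in> S" for A B
    using Equiv[OF that] fa_iff[OF that(1)] fa_iff[OF that(2)] binary_S[OF that, THEN fa_iff]
    by (cases "tr A"; cases "tr B"; simp)
  \<comment> \<open>If not every instance is true, bivalence yields a false one and the falsity rule
    applies.\<close>
  have univ_iff: "tr (univ P) \<longleftrightarrow> (\<forall>x\<in>domain P. tr (inst P x))" if "P \<in> Q" for P
    using univ[of P] that pred_S fa_iff by blast
  have exis_iff: "tr (exis P) \<longleftrightarrow> (\<exists>x\<in>domain P. tr (inst P x))" if "P \<in> Q" for P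
    using exis[of P] that pred_S fa_iff by blast
  show ?thesis
    unfolding fully_interpreted_def
    using language
    by (auto simp: fa_iff Neg_S binary_S pred_S
        Neg_iff Disj_iff Conj_iff Impl_iff Equiv_iff univ_iff exis_iff)
qed

section \<open>Closure of \<open>G\<close> under its generating rules\<close>

lemma G_stage_mono: "m \<le> n \<Longrightarrow> G_stage L U m \<subseteq> G_stage L U n"
  by (rule lift_Suc_mono_le) (auto simp: G_step_def Let_def)

lemma G_zero_subset_G: "G_zero L U \<subseteq> G L U"
  unfolding G_def using G_stage.simps(1)[of L U] by blast

text \<open>The stages increase, so a finite part of their union lies in a single stage, and one
  step from there stays in the union. Each rule has finitely many premises, so finite sets
  suffice.\<close>

lemma G_step_finite_subset:
  assumes "finite X" "X \<subseteq> G L U"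
  shows "G_step L X \<subseteq> G L U"
proof -
  have "\<exists>n. X \<subseteq> G_stage L U n"
    using assms
  proof (induction X rule: finite_induct)
    case (insert c X)
    then obtain m n where "c \<in> G_stage L U m" "X \<subseteq> G_stage L U n"
      by (auto simp: G_def)
    then have "insert c X \<subseteq> G_stage L U (max m n)"
      using G_stage_mono[of m "max m n" L U] G_stage_mono[of n "max m n" L U] by auto
    then show ?case ..
  qed simp
  then obtain n where "X \<subseteq> G_stage L U n" ..
  \<comment> \<open>\<open>G_step\<close> is monotone because \<open>X\<close> occurs only
    positively in each of its sets.\<close>
  then have "G_step L X \<subseteq> G_stage L U (Suc n)"
    unfolding G_stage.simps G_step_def Let_def by (intro Un_mono) blast+
  then show ?thesis
    unfolding G_def by blast
qed

lemma G_step_intros: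
  assumes "A \<in> LL L" "B \<in> LL L"
  shows "GN L A \<in> X \<Longrightarrow> GN L (Neg L (Neg L A)) \<in> G_step L X"
    and "GN L A \<in> X \<or> GN L B \<in> X \<Longrightarrow> GN L (Disj L A B) \<in> G_step L X"
    and "GN L A \<in> X \<Longrightarrow> GN L B \<in> X \<Longrightarrow> GN L (Conj L A B) \<in> G_step L X"
    and "GN L (Neg L A) \<in> X \<or> GN L B \<in> X \<Longrightarrow> GN L (Impl L A B) \<in> G_step L X"
    and "GN L A \<in> X \<and> GN L B \<in> X \<or> GN L (Neg L A) \<in> X \<and> GN L (Neg L B) \<in> X \<Longrightarrow>
      GN L (Equiv L A B) \<in> G_step L X"
    and "GN L (Neg L A) \<in> X \<Longrightarrow> GN L (Neg L B) \<in> X \<Longrightarrow> GN L (Neg L (Disj L A B)) \<in> G_step L X"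
    and "GN L (Neg L A) \<in> X \<or> GN L (Neg L B) \<in> X \<Longrightarrow> GN L (Neg L (Conj L A B)) \<in> G_step L X"
    and "GN L A \<in> X \<Longrightarrow> GN L (Neg L B) \<in> X \<Longrightarrow> GN L (Neg L (Impl L A B)) \<in> G_step L X"
    and "GN L A \<in> X \<and> GN L (Neg L B) \<in> X \<or> GN L (Neg L A) \<in> X \<and> GN L B \<in> X \<Longrightarrow>
      GN L (Neg L (Equiv L A B)) \<in> G_step L X"
  unfolding G_step_def Let_def
  \<comment> \<open>The union nests to the left: the outermost right-hand set is tried first, and if
    the shape of the sentence does not match, the search moves one set to the left.\<close>
  by (((rule UnI2, rule CollectI, (rule exI)+, rule conjI, rule refl, use assms in simp) | rule UnI1)+)

section \<open>Closure of the full language \<open>LL\<close>\<close>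

lemma LL_base: "Sent L \<union> T_sentences L \<subseteq> LL L"
  unfolding LL_def using LL_stage.simps(1)[of L] by blast

lemma LL_stage_mono: "m \<le> n \<Longrightarrow> LL_stage L m \<subseteq> LL_stage L n"
  by (rule lift_Suc_mono_le) auto

lemma LL_Neg:
  assumes "A \<in> LL L"
  shows "Neg L A \<in> LL L"
proof -
  obtain n where "A \<in> LL_stage L n"
    using assms by (auto simp: LL_def)
  then have "Neg L A \<in> LL_stage L (Suc n)"
    by auto
  then show ?thesis
    unfolding LL_def by (auto simp del: LL_stage.simps)
qed

lemma LL_binary:
  assumes "A \<in> LL L" "B \<in> LL L"
  shows "Disj L A B \<in> LL L" "Conj L A B \<in> LL L" "Impl L A B \<in> LL L" "Equiv L A B \<in> LL L"
proof -
  from assms obtain m n where "A \<in> LL_stage L m" "B \<in> LL_stage L n"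
    by (auto simp: LL_def)
  then have AB: "A \<in> LL_stage L (max m n)" "B \<in> LL_stage L (max m n)"
    using LL_stage_mono[of m "max m n" L] LL_stage_mono[of n "max m n" L] by auto
  have "Disj L A B \<in> LL_stage L (Suc (max m n))" "Conj L A B \<in> LL_stage L (Suc (max m n))"
    "Impl L A B \<in> LL_stage L (Suc (max m n))" "Equiv L A B \<in> LL_stage L (Suc (max m n))"
    unfolding LL_stage.simps
    by (((rule UnI2, rule CollectI, (rule exI)+, rule conjI, rule refl, use AB in simp) | rule UnI1)+)
  then show "Disj L A B \<in> LL L" "Conj L A B \<in> LL L" "Impl L A B \<in> LL L" "Equiv L A B \<in> LL L"
    unfolding LL_def by (auto simp del: LL_stage.simps)
qed

lemma T_quote_LL: "T L (quote L A) \<in> LL L"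
  using LL_base[of L] by (auto simp: T_sentences_def quote_def)

section \<open>Truth and falsity in a consistent fixed point\<close>

locale consistent_fixed_point = truth_extension L
  for L :: "('c::countable, 'x) truth_language" +
  fixes U :: "nat set"
  assumes base: "fully_interpreted L (Sent L) (predicate_of L ` Pred L) (Tru L) (Fls L)"
    and consistent: "consistent L U"
    and fixed: "U = G L U"
begin

abbreviation tr :: "'c list \<Rightarrow> bool" where "tr A \<equiv> GN L A \<in> G L U"
abbreviation fa :: "'c list \<Rightarrow> bool" where "fa A \<equiv> GN L A \<in> F L U"

text \<open>\<open>F\<close> collects codes, which might a priori stem from another sentence;
  injectivity of the Goedel numbering on \<open>LL\<close> excludes this.\<close>

lemma fa_iff: "A \<in> LL L \<Longrightarrow> fa A \<longleftrightarrow> tr (Neg L A)"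
  using GN_inj unfolding F_def inj_on_def by blast

text \<open>Consistency is a property of \<open>U\<close>; the fixed point equation carries it over
  to \<open>G L U\<close>.\<close>

lemma not_tr_fa: "A \<in> LL L \<Longrightarrow> \<not> (tr A \<and> fa A)"
  using consistent fixed fa_iff unfolding consistent_def by blast

lemma L0_iff: "A \<in> L0 L U \<longleftrightarrow> A \<in> LL L \<and> (tr A \<or> fa A)"
  by (simp add: L0_def)

text \<open>The first half is the double negation rule of \<open>G_step\<close>, the second the
  definition of \<open>F\<close>.\<close>

lemma tr_fa_Neg:
  assumes "A \<in> LL L"
  shows "tr A \<Longrightarrow> fa (Neg L A)" "fa A \<Longrightarrow> tr (Neg L A)"
proof -
  have "tr (Neg L (Neg L A))" if "tr A"
    using G_step_intros(1)[OF assms assms, of "{GN L A}"] G_step_finite_subset[of "{GN L A}" L U] that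
    by auto
  then show "tr A \<Longrightarrow> fa (Neg L A)"
    by (simp add: fa_iff LL_Neg assms)
  show "fa A \<Longrightarrow> tr (Neg L A)"
    by (simp add: fa_iff assms)
qed

lemma tr_fa_binary:
  assumes "A \<in> LL L" "B \<in> LL L"
  shows tr_Disj: "tr A \<or> tr B \<Longrightarrow> tr (Disj L A B)"
    and fa_Disj: "fa A \<Longrightarrow> fa B \<Longrightarrow> fa (Disj L A B)"
    and tr_Conj: "tr A \<Longrightarrow> tr B \<Longrightarrow> tr (Conj L A B)"
    and fa_Conj: "fa A \<or> fa B \<Longrightarrow> fa (Conj L A B)"
    and tr_Impl: "fa A \<or> tr B \<Longrightarrow> tr (Impl L A B)"
    and fa_Impl: "tr A \<Longrightarrow> fa B \<Longrightarrow> fa (Impl L A B)"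
    and tr_Equiv: "tr A \<and> tr B \<or> fa A \<and> fa B \<Longrightarrow> tr (Equiv L A B)"
    and fa_Equiv: "tr A \<and> fa B \<or> fa A \<and> tr B \<Longrightarrow> fa (Equiv L A B)"
proof -
  \<comment> \<open>These four codes are all that a binary rule inspects. Intersecting with
    \<open>G L U\<close> gives a finite subset of it, whichever of them are present.\<close>
  let ?X = "{GN L A, GN L B, GN L (Neg L A), GN L (Neg L B)} \<inter> G L U"
  have "G_step L ?X \<subseteq> G L U"
    by (rule G_step_finite_subset) auto
  note step = subsetD[OF this]
  note intros = G_step_intros[OF assms, of ?X, THEN step]
  note fa = fa_iff[OF assms(1)] fa_iff[OF assms(2)] LL_binary[OF assms, THEN fa_iff]
  show "tr A \<or> tr B \<Longrightarrow> tr (Disj L A B)" "fa A \<Longrightarrow> fa B \<Longrightarrow> fa (Disj L A B)"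
    "tr A \<Longrightarrow> tr B \<Longrightarrow> tr (Conj L A B)" "fa A \<or> fa B \<Longrightarrow> fa (Conj L A B)"
    "fa A \<or> tr B \<Longrightarrow> tr (Impl L A B)" "tr A \<Longrightarrow> fa B \<Longrightarrow> fa (Impl L A B)"
    "tr A \<and> tr B \<or> fa A \<and> fa B \<Longrightarrow> tr (Equiv L A B)"
    "tr A \<and> fa B \<or> fa A \<and> tr B \<Longrightarrow> fa (Equiv L A B)"
    unfolding fa using intros(2-) by simp_all
qed

section \<open>The base language inside \<open>L0\<close>\<close>

lemma Sent_tr_fa:
  assumes "A \<in> Sent L"
  shows tr_Sent: "Tru L A \<Longrightarrow> tr A" and fa_Sent: "Fls L A \<Longrightarrow> fa A"
proof -
  have W: "tr B" if "B \<in> Sent L" "Tru L B" for B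
    using that G_zero_subset_G[of L U] unfolding G_zero_def W_def by (auto split: if_splits)
  show "Tru L A \<Longrightarrow> tr A"
    using W assms by blast
  \<comment> \<open>Falsity goes through negation: \<open>Neg L A\<close> is then a true sentence of
    the base language, so its code is in \<open>W\<close>.\<close>
  show "Fls L A \<Longrightarrow> fa A"
    using W[of "Neg L A"] assms base LL_base[of L]
    by (auto simp: fa_iff fully_interpreted_def language_def)
qed

text \<open>Bivalence of the base language decides all its sentences. This makes \<open>L0\<close>
  infinite.\<close>

lemma Sent_L0: "Sent L \<subseteq> L0 L U"
proof
  fix A
  assume "A \<in> Sent L"
  moreover from this have "Tru L A \<or> Fls L A"
    using base by (simp add: fully_interpreted_def)
  ultimately show "A \<in> L0 L U"
    using Sent_tr_fa[of A] LL_base[of L] by (auto simp: L0_iff)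
qed

lemma infinite_L0: "infinite (L0 L U)"
  using base Sent_L0 finite_subset by (auto simp: fully_interpreted_def language_def)

lemma L0_Neg: "A \<in> L0 L U \<Longrightarrow> Neg L A \<in> L0 L U"
  using tr_fa_Neg LL_Neg by (auto simp: L0_iff)

lemma L0_binary:
  assumes "A \<in> L0 L U" "B \<in> L0 L U"
  shows "Disj L A B \<in> L0 L U" "Conj L A B \<in> L0 L U" "Impl L A B \<in> L0 L U" "Equiv L A B \<in> L0 L U"
proof -
  from assms have LL: "A \<in> LL L" "B \<in> LL L" and "tr A \<or> fa A" "tr B \<or> fa B"
    by (simp_all add: L0_iff)
  with tr_fa_binary[OF LL] LL_binary[OF LL]
  show "Disj L A B \<in> L0 L U" "Conj L A B \<in> L0 L U" "Impl L A B \<in> L0 L U" "Equiv L A B \<in> L0 L U"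
    unfolding L0_iff by argo+
qed

text \<open>Any sentence of \<open>L0\<close> together with its negation provides both values. The
  pair later settles the quantifiers over \<open>X_T\<close>.\<close>

lemma ex_tr_fa: obtains A B where "A \<in> L0 L U" "tr A" "B \<in> L0 L U" "fa B"
proof -
  obtain A where "A \<in> L0 L U"
    using infinite_L0 by fastforce
  then show ?thesis
    using that[of A "Neg L A"] that[of "Neg L A" A] tr_fa_Neg[of A] L0_Neg[of A]
    by (auto simp: L0_iff)
qed

section \<open>The predicate \<open>T\<close> on codes of sentences\<close>

text \<open>This selects the branch of \<open>G_zero\<close> that contains the clauses for
  \<open>T\<close>.\<close>

lemma U_nonempty: "U \<noteq> {}"
proof -
  obtain A where "tr A" using ex_tr_fa by blast
  then show ?thesis using fixed by blast
qed

text \<open>The clauses of \<open>G_zero\<close> for \<open>T\<close> refer to \<open>U\<close>;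
  since \<open>U = G L U\<close>, they become rules about \<open>tr\<close> and \<open>fa\<close>
  themselves.\<close>

lemma tr_fa_T:
  assumes "A \<in> LL L"
  shows tr_T: "tr A \<Longrightarrow> tr (T L (quote L A))" and fa_T: "fa A \<Longrightarrow> fa (T L (quote L A))"
proof -
  have "{GN L (T L (quote L A)) | A. A \<in> LL L \<and> tr A} \<subseteq> G L U"
    "{GN L (Neg L (T L (quote L A))) | A. A \<in> LL L \<and> tr (Neg L A)} \<subseteq> G L U"
    using U_nonempty G_zero_subset_G[of L U] fixed by (auto simp: G_zero_def)
  then show "tr A \<Longrightarrow> tr (T L (quote L A))" "fa A \<Longrightarrow> fa (T L (quote L A))"
    using assms unfolding fa_iff[OF assms] fa_iff[OF T_quote_LL] by blast+
qed

lemma T_L0: "A \<in> L0 L U \<Longrightarrow> T L (quote L A) \<in> L0 L U"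
  using tr_fa_T T_quote_LL by (auto simp: L0_iff)

text \<open>\<open>A\<close> is decided and \<open>T\<close> passes its value on; the converses hold
  because neither \<open>A\<close> nor the sentence with \<open>T\<close> can have both
  values.\<close>

lemma T_iff:
  assumes "A \<in> L0 L U"
  shows "tr (T L (quote L A)) \<longleftrightarrow> tr A" and "fa (T L (quote L A)) \<longleftrightarrow> fa A"
proof -
  have "A \<in> LL L" "tr A \<or> fa A"
    using assms by (simp_all add: L0_iff)
  then show "tr (T L (quote L A)) \<longleftrightarrow> tr A" "fa (T L (quote L A)) \<longleftrightarrow> fa A"
    using tr_fa_T[of A] not_tr_fa[of A] not_tr_fa[OF T_quote_LL[of L A]] by blast+
qed

section \<open>Quantified sentences with \<open>T\<close>\<close>

lemma quantified_T_LL: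
  "ForallT L \<in> LL L" "ExistsT L \<in> LL L" "ForallTT L \<in> LL L" "ExistsTT L \<in> LL L"
  "P \<in> Pred L \<Longrightarrow> ForallTP L P \<in> LL L" "P \<in> Pred L \<Longrightarrow> ExistsTP L P \<in> LL L"
  using LL_base[of L] by (auto simp: T_sentences_def)

lemma quantified_T:
  "fa (ForallT L)" "tr (ExistsT L)" "fa (ForallTT L)" "tr (ExistsTT L)"
  using U_nonempty G_zero_subset_G[of L U] quantified_T_LL
  by (auto simp: fa_iff G_zero_def)

lemma quantified_TP:
  shows tr_ForallTP: "P \<in> P1 L \<Longrightarrow> tr (ForallTP L P)"
    and fa_ForallTP: "P \<in> P2 L \<union> P3 L \<Longrightarrow> fa (ForallTP L P)"
    and tr_ExistsTP: "P \<in> P1 L \<union> P3 L \<Longrightarrow> tr (ExistsTP L P)"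
    and fa_ExistsTP: "P \<in> P2 L \<Longrightarrow> fa (ExistsTP L P)"
proof -
  have Pred: "P \<in> Pred L" if "P \<in> P1 L \<union> P2 L \<union> P3 L"
    using that by (auto simp: P1_def P2_def P3_def)
  show "P \<in> P1 L \<Longrightarrow> tr (ForallTP L P)" "P \<in> P2 L \<union> P3 L \<Longrightarrow> fa (ForallTP L P)"
    "P \<in> P1 L \<union> P3 L \<Longrightarrow> tr (ExistsTP L P)" "P \<in> P2 L \<Longrightarrow> fa (ExistsTP L P)"
    using U_nonempty G_zero_subset_G[of L U] quantified_T_LL Pred
    by (auto simp: fa_iff G_zero_def)
qed

lemma Pred_Sent:
  assumes "P \<in> Pred L"
  shows "Dom L P \<noteq> {}" "x \<in> Dom L P \<Longrightarrow> Inst L P x \<in> Sent L"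
    "Forall L P \<in> Sent L" "Exists L P \<in> Sent L"
  using base assms by (auto simp: fully_interpreted_def language_def predicate_of_def)

text \<open>Every instance of \<open>P\<close> is true or false in the base language, so if none is
  true, all are false.\<close>

lemma Pred_cases:
  assumes "P \<in> Pred L"
  obtains "P \<in> P1 L" | "P \<in> P2 L" | "P \<in> P3 L"
  using assms base Pred_Sent(2)[OF assms]
  by (fastforce simp: fully_interpreted_def P1_def P2_def P3_def)

text \<open>The converse of \<open>Sent_tr_fa\<close> comes from bivalence in the base language and
  consistency of \<open>U\<close>.\<close>

lemma Sent_iff:
  assumes "A \<in> Sent L"
  shows "tr A \<longleftrightarrow> Tru L A" "fa A \<longleftrightarrow> Fls L A"
  using assms base Sent_tr_fa[of A] not_tr_fa[of A] LL_base[of L]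
  by (auto simp: fully_interpreted_def)

section \<open>Closure of \<open>L0\<close> and the quantifier rules\<close>

lemma L0_predicates_cases:
  assumes "Q \<in> L0_predicates L U"
  obtains
    (Pred) P where "P \<in> Pred L" "Q = predicate_of L P"
  | (T) "domain Q = X_T L U" "inst Q = T L" "univ Q = ForallT L" "exis Q = ExistsT L"
  | (TT) "domain Q = X_T L U" "inst Q = (\<lambda>x. T L (quote L (T L x)))"
      "univ Q = ForallTT L" "exis Q = ExistsTT L"
  | (TP) P where "P \<in> Pred L" "domain Q = Dom L P"
      "inst Q = (\<lambda>x. T L (quote L (Inst L P x)))" "univ Q = ForallTP L P" "exis Q = ExistsTP L P"
  using assms unfolding L0_predicates_def by auto

lemma language_L0: "language L (L0 L U) (L0_predicates L U)"
proof -
  have X_T: "X_T L U \<noteq> {}"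
    using ex_tr_fa unfolding X_T_def by blast
  have "domain Q \<noteq> {} \<and> (\<forall>x\<in>domain Q. inst Q x \<in> L0 L U) \<and> univ Q \<in> L0 L U \<and> exis Q \<in> L0 L U"
    if "Q \<in> L0_predicates L U" for Q
    using that
  proof (cases rule: L0_predicates_cases)
    case (Pred P)
    then show ?thesis
      using Pred_Sent[of P] Sent_L0 by (auto simp: predicate_of_def)
  next
    case T
    then show ?thesis
      using X_T T_L0 quantified_T quantified_T_LL by (auto simp: X_T_def L0_iff[of "ForallT L"] L0_iff[of "ExistsT L"])
  next
    case TT
    then show ?thesis
      using X_T T_L0 quantified_T quantified_T_LL by (auto simp: X_T_def L0_iff[of "ForallTT L"] L0_iff[of "ExistsTT L"])
  next
    case (TP P)
    \<comment> \<open>Each of the three classes of predicates assigns a value to both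
      sentences.\<close>
    have "ForallTP L P \<in> L0 L U \<and> ExistsTP L P \<in> L0 L U"
      using Pred_cases[OF TP(1)] quantified_TP[of P] quantified_T_LL TP(1) by (auto simp: L0_iff)
    then show ?thesis
      using TP Pred_Sent[OF TP(1)] T_L0 Sent_L0 by auto
  qed
  then show ?thesis
    unfolding language_def using infinite_L0 L0_Neg L0_binary by simp
qed

text \<open>Predicates of the base language inherit the rules. Over \<open>X_T\<close> both values
  occur among the instances, in agreement with the values fixed in \<open>G_zero\<close>. For the
  remaining predicates the classes \<open>P1\<close>, \<open>P2\<close>, \<open>P3\<close>
  decide.\<close>

lemma quantifier_rules:
  assumes "Q \<in> L0_predicates L U"
  shows tr_univ: "\<forall>x\<in>domain Q. tr (inst Q x) \<Longrightarrow> tr (univ Q)"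
    and fa_univ: "x \<in> domain Q \<Longrightarrow> fa (inst Q x) \<Longrightarrow> fa (univ Q)"
    and tr_exis: "x \<in> domain Q \<Longrightarrow> tr (inst Q x) \<Longrightarrow> tr (exis Q)"
    and fa_exis: "\<forall>x\<in>domain Q. fa (inst Q x) \<Longrightarrow> fa (exis Q)"
proof -
  \<comment> \<open>In the cases \<open>T\<close> and \<open>TT\<close>, \<open>B\<close> defeats
    the premise that all instances are true and \<open>A\<close> the premise that all are
    false.\<close>
  obtain A B where AB: "A \<in> L0 L U" "\<not> fa A" "B \<in> L0 L U" "\<not> tr B"
    using ex_tr_fa not_tr_fa L0_iff by metis
  have "((\<forall>x\<in>domain Q. tr (inst Q x)) \<longrightarrow> tr (univ Q)) \<and> ((\<exists>x\<in>domain Q. fa (inst Q x)) \<longrightarrow> fa (univ Q)) \<and>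
      ((\<exists>x\<in>domain Q. tr (inst Q x)) \<longrightarrow> tr (exis Q)) \<and> ((\<forall>x\<in>domain Q. fa (inst Q x)) \<longrightarrow> fa (exis Q))"
    using assms
  proof (cases rule: L0_predicates_cases)
    case (Pred P)
    then show ?thesis
      using base Pred_Sent[OF Pred(1)]
      by (auto simp: Sent_iff fully_interpreted_def predicate_of_def)
  next
    case T
    with AB quantified_T show ?thesis
      by (auto simp: X_T_def T_iff)
  next
    case TT
    with AB quantified_T show ?thesis
      \<comment> \<open>\<open>T_iff\<close> is applied twice; \<open>T_L0\<close> keeps the inner
        sentence in \<open>L0\<close> for the outer application.\<close>
      by (auto simp: X_T_def T_iff T_L0)
  next
    case (TP P)
    have *: "\<not> (Tru L (Inst L P x) \<and> Fls L (Inst L P x))" if "x \<in> Dom L P" for x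
      using base Pred_Sent(2)[OF TP(1) that] by (auto simp: fully_interpreted_def)
    have T_Inst: "tr (T L (quote L (Inst L P x))) \<longleftrightarrow> Tru L (Inst L P x)"
      "fa (T L (quote L (Inst L P x))) \<longleftrightarrow> Fls L (Inst L P x)" if "x \<in> Dom L P" for x
      using Pred_Sent(2)[OF TP(1) that] Sent_L0 by (auto simp: T_iff Sent_iff)
    from Pred_cases[OF TP(1)] show ?thesis
      \<comment> \<open>Exclusivity rules out instances of the wrong value; nonemptiness of the
        domain keeps \<open>P1\<close> and \<open>P2\<close> from satisfying the opposite premise
        vacuously.\<close>
      using TP * Pred_Sent(1)[OF TP(1)] quantified_TP[of P]
      by cases (fastforce simp: T_Inst P1_def P2_def P3_def)+
  qed
  then show "\<forall>x\<in>domain Q. tr (inst Q x) \<Longrightarrow> tr (univ Q)"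
    "x \<in> domain Q \<Longrightarrow> fa (inst Q x) \<Longrightarrow> fa (univ Q)"
    "x \<in> domain Q \<Longrightarrow> tr (inst Q x) \<Longrightarrow> tr (exis Q)"
    "\<forall>x\<in>domain Q. fa (inst Q x) \<Longrightarrow> fa (exis Q)"
    by blast+
qed

lemma fully_interpreted_L0: "fully_interpreted L (L0 L U) (L0_predicates L U) tr fa"
proof (rule fully_interpretedI[OF language_L0])
qed ((rule quantifier_rules; assumption) | (simp add: L0_iff not_tr_fa tr_fa_Neg tr_fa_binary; fail))+

end

theorem proposition3p2:
  fixes L :: "('c::countable, 'x) truth_language" and U :: "nat set"
  assumes "fully_interpreted L (Sent L) (predicate_of L ` Pred L) (Tru L) (Fls L)"
    and "truth_extension L"
    and "\<not> has_truth_predicate L"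
    and "smallest_consistent_fixed_point L U"
  shows "fully_interpreted L (L0 L U) (L0_predicates L U)
           (\<lambda>A. GN L A \<in> G L U) (\<lambda>A. GN L A \<in> F L U)"
proof -
  interpret truth_extension L by (fact assms(2))
  interpret consistent_fixed_point L U
    using assms(1,4) by unfold_locales (auto simp: smallest_consistent_fixed_point_def)
  show ?thesis by (rule fully_interpreted_L0)
qed

end
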